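(* Let $\mathfrak g:=(g_1,\ldots,g_m,g_{m+1})\in\mathbb{R}[\mathtt x']^{m+1}$ be an admissible tuple of polynomials of length $m+1$, with $m\ge1$. Then there exists a polynomial $Q_{\mathfrak g}\in\mathbb{R}[\mathtt x]$ such that: (i) $\{Q_{\mathfrak g}\le 0\}\subset\{(x',x_n)\in\mathbb{R}^n:\ (x',0)\in\mathcal A(\mathfrak g),\ |x_n|>\max\{g_{m+1}(x'),\tfrac{g_{m+1}(x')}{\sqrt{g_1(x')\cdots g_m(x')}}\}\}$. (ii) For each $(x',0)\in\mathcal A(\mathfrak g)$ there exist a positive root $r\ge g_{m+1}(x')$ of the univariate polynomial $Q_{\mathfrak g}(x',\mathtt t)$ and a value $t\ge r$ such that $Q_{\mathfrak g}(x',t)=-1$. (iii) The set $$\mathcal S(\mathfrak g):=\{(x',x_n+\lambda):\ Q_{\mathfrak g}(x',x_n)\le 0,\ x_n>0,\ \lambda\ge 0\}$$ satisfies $\pi_n(\mathcal S(\mathfrak g))=\mathcal A(\mathfrak g)$. In addition, for each $(x',x_n)\in\mathcal S(\mathfrak g)$ there exist $r_n>0$ and $t_n\ge 0$ such that $x_n=r_n+t_n$ and $Q_{\mathfrak g}(x',r_n)=0$.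
   Context: Points of $\mathbb{R}^n=\mathbb{R}^{n-1}\times\mathbb{R}$ are written $x=(x',x_n)$ with $x'=(x_1,\dots,x_{n-1})$; $\mathbb{R}[\mathtt x']:=\mathbb{R}[\mathtt x_1,\dots,\mathtt x_{n-1}]$, $\mathbb{R}[\mathtt x]:=\mathbb{R}[\mathtt x_1,\dots,\mathtt x_n]$, and $\pi_n:\mathbb{R}^n\to\mathbb{R}^n$, $(x',x_n)\mapsto(x',0)$. An admissible tuple of polynomials of length $m+1$ is a tuple $\mathfrak g=(g_1,\ldots,g_m,g_{m+1})\in\mathbb{R}[\mathtt x']^{m+1}$ such that $g_{m+1}>1$ on $\mathbb{R}^{n-1}$. Its associated set is $\mathcal A(\mathfrak g):=\{(x',0)\in\mathbb{R}^n:\ g_1(x')>0,\ldots,g_m(x')>0\}$. *)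

theory Defs
  imports
    Complex_Main
    "HOL-Library.FuncSet"
    "HOL-Library.Poly_Mapping"
    "HOL-Computational_Algebra.Polynomial"
begin

text \<open>
  The dimension is a natural number, so that the passage between dimensions \<open>n - 1\<close> and \<open>n\<close>
  (including \<open>n = 1\<close>) can be stated: a point of \<open>\<real>\<^sup>n\<close> is an extensional function on the index
  set \<open>{1..n}\<close>.
\<close>

definition Rn :: "nat \<Rightarrow> (nat \<Rightarrow> real) set" where
  "Rn n = {1..n} \<rightarrow>\<^sub>E UNIV"

text \<open>The point \<open>(x', t)\<close> of \<open>\<real>\<^sup>n\<close> for \<open>x'\<close> in \<open>Rn (n - 1)\<close>, where \<open>n \<ge> 1\<close>.\<close>

definition pt :: "nat \<Rightarrow> (nat \<Rightarrow> real) \<Rightarrow> real \<Rightarrow> nat \<Rightarrow> real" where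
  "pt n x' t = x'(n := t)"

definition proj_last :: "nat \<Rightarrow> (nat \<Rightarrow> real) \<Rightarrow> nat \<Rightarrow> real" where
  "proj_last n x = x(n := 0)"

text \<open>
  Real polynomials in the indeterminates indexed by \<open>nat\<close>, as finitely supported maps from monomials
  (finitely supported exponent vectors) to coefficients; the ring structure is the convolution
  structure on \<open>\<Rightarrow>\<^sub>0\<close>.
\<close>

type_synonym real_mpoly = "(nat \<Rightarrow>\<^sub>0 nat) \<Rightarrow>\<^sub>0 real"

definition mpoly_ring :: "nat \<Rightarrow> real_mpoly set" where
  "mpoly_ring n = {p. \<forall>\<alpha> \<in> Poly_Mapping.keys p. Poly_Mapping.keys \<alpha> \<subseteq> {1..n}}"

definition ev :: "real_mpoly \<Rightarrow> (nat \<Rightarrow> real) \<Rightarrow> real" where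
  "ev p x = (\<Sum>\<alpha> \<in> Poly_Mapping.keys p. Poly_Mapping.lookup p \<alpha> *
     (\<Prod>i \<in> Poly_Mapping.keys \<alpha>. x i ^ Poly_Mapping.lookup \<alpha> i))"

text \<open>The univariate polynomial \<open>p(x', \<t>)\<close> obtained by substituting \<open>x'\<close> for all
  indeterminates but the \<open>n\<close>-th.\<close>

definition spec_last :: "nat \<Rightarrow> real_mpoly \<Rightarrow> (nat \<Rightarrow> real) \<Rightarrow> real poly" where
  "spec_last n p x' = (\<Sum>\<alpha> \<in> Poly_Mapping.keys p.
     monom (Poly_Mapping.lookup p \<alpha> *
            (\<Prod>i \<in> Poly_Mapping.keys \<alpha> - {n}. x' i ^ Poly_Mapping.lookup \<alpha> i))
           (Poly_Mapping.lookup \<alpha> n))"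

lemma poly_spec_last: "poly (spec_last n p x') t = ev p (pt n x' t)"
proof -
  have "(\<Prod>i \<in> Poly_Mapping.keys \<alpha>. pt n x' t i ^ Poly_Mapping.lookup \<alpha> i) =
      (\<Prod>i \<in> Poly_Mapping.keys \<alpha> - {n}. x' i ^ Poly_Mapping.lookup \<alpha> i) *
      t ^ Poly_Mapping.lookup \<alpha> n" for \<alpha> :: "nat \<Rightarrow>\<^sub>0 nat"
  proof (cases "n \<in> Poly_Mapping.keys \<alpha>")
    case True
    then show ?thesis
      by (simp add: prod.remove pt_def)
  next
    case False
    then have "(\<Prod>i \<in> Poly_Mapping.keys \<alpha>. pt n x' t i ^ Poly_Mapping.lookup \<alpha> i) =
        (\<Prod>i \<in> Poly_Mapping.keys \<alpha>. x' i ^ Poly_Mapping.lookup \<alpha> i)"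
      by (intro prod.cong) (auto simp: pt_def)
    with False show ?thesis
      by (simp add: in_keys_iff)
  qed
  then show ?thesis
    by (simp add: spec_last_def ev_def poly_sum poly_monom mult.assoc)
qed

text \<open>A tuple \<open>(g\<^sub>1, \<dots>, g\<^sub>m\<^sub>+\<^sub>1)\<close> is a function on \<open>nat\<close> of which only the values on
  \<open>{1..m + 1}\<close> matter.\<close>

definition admissible_tuple :: "nat \<Rightarrow> nat \<Rightarrow> (nat \<Rightarrow> real_mpoly) \<Rightarrow> bool" where
  "admissible_tuple n m g \<longleftrightarrow>
     (\<forall>i \<in> {1..m + 1}. g i \<in> mpoly_ring (n - 1)) \<and>
     (\<forall>x' \<in> Rn (n - 1). ev (g (m + 1)) x' > 1)"

definition assoc_set :: "nat \<Rightarrow> nat \<Rightarrow> (nat \<Rightarrow> real_mpoly) \<Rightarrow> (nat \<Rightarrow> real) set" where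
  "assoc_set n m g =
     {pt n x' 0 | x'. x' \<in> Rn (n - 1) \<and> (\<forall>i \<in> {1..m}. ev (g i) x' > 0)}"

definition upper_set :: "nat \<Rightarrow> real_mpoly \<Rightarrow> (nat \<Rightarrow> real) set" where
  "upper_set n Q =
     {pt n x' (t + l) | x' t l. x' \<in> Rn (n - 1) \<and> ev Q (pt n x' t) \<le> 0 \<and> t > 0 \<and> l \<ge> 0}"

end

theory Submission imports Defs
begin

text \<open>
  Write \<open>G = g\<^sub>m\<^sub>+\<^sub>1\<close>, \<open>p = g\<^sub>1 \<cdots> g\<^sub>m\<close> and \<open>W = \<Prod>\<^sub>i (1 + g\<^sub>i\<^sup>2)\<close>.  The idea is to encode
  the \<open>m\<close> conditions \<open>g\<^sub>i > 0\<close> in the reality of one nested square root.  An inequality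
  \<open>\<bar>a u\<^sup>2 - 2 c\<bar> \<le> \<bar>c\<bar>\<close> with \<open>a > 0\<close> and \<open>c \<noteq> 0\<close> forces \<open>c > 0\<close>, because \<open>a u\<^sup>2 \<ge> 0\<close>, and it bounds \<open>u\<close>
  in terms of \<open>c\<close>.  Such inequalities can therefore be chained: the bound on \<open>u\<close> is the inequality
  of the next link when \<open>u\<close> is itself of the form \<open>a' w\<^sup>2 - 2 c'\<close> and the bound is \<open>\<bar>c'\<bar>\<close>.
  The quantities \<open>c = g\<^sub>i q\<^sup>2\<close>, with \<open>q\<close> the previous \<open>c\<close>, and \<open>a = 4 (1 + g\<^sub>i\<^sup>2)\<close> achieve this
  with polynomial coefficients, and one final inequality \<open>u\<^sup>2 \<le> q\<^sup>2\<close> controls the whole chain.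
  This is \<open>tower\<close>: if \<open>tower gs q u \<le> 0\<close>, then \<open>\<bar>u\<bar> \<le> \<bar>q\<bar>\<close>, and all entries of \<open>gs\<close> are positive
  provided that neither they nor \<open>q\<close> vanish.

  The chain starts from \<open>q = 1\<close> and \<open>u = p t\<^sup>2 - (2 + G\<^sup>2 W)\<close>, where \<open>t\<close> is the last variable.
  From \<open>\<bar>u\<bar> \<le> 1\<close> follows \<open>p t\<^sup>2 > G\<^sup>2 W \<ge> 0\<close>.  Hence \<open>p\<close> is positive, so that no \<open>g\<^sub>i\<close> vanishes and
  the tower gives \<open>g\<^sub>i > 0\<close> for all \<open>i\<close>; moreover \<open>t\<^sup>2 > G\<^sup>2\<close> and \<open>t\<^sup>2 > G\<^sup>2 / p\<close>, because
  \<open>W\<close> is at least \<open>p\<close> and at least \<open>1\<close>.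

  Conversely, over a point where all \<open>g\<^sub>i\<close> are positive, the nested square root exists and the tower
  becomes negative there, but only by an amount that tends to \<open>0\<close> when the point approaches the
  boundary of the set \<open>{g\<^sub>1 > 0, \<dots>, g\<^sub>m > 0}\<close>.  On the way to the boundary the dip escapes to infinity in
  the \<open>t\<close>-direction, \<open>t\<^sup>2 \<ge> W / p\<close>, and so the factor \<open>(1 + t\<^sup>2)\<^bsup>2^m\<^esup>\<close> compensates for this.
  It changes neither signs nor real roots, and makes the value at the dip at most \<open>-1\<close>
  (\<open>separator_dip\<close>).  At \<open>t = 0\<close> the polynomial is positive, so the intermediate value theorem
  supplies a root before every positive \<open>t\<close> where it is nonpositive, and the value \<open>-1\<close> after the
  root that precedes the dip.
\<close>

section \<open>Polynomial functions\<close>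

definition monom_val :: "(nat \<Rightarrow>\<^sub>0 nat) \<Rightarrow> (nat \<Rightarrow> real) \<Rightarrow> real" where
  "monom_val \<alpha> x = (\<Prod>i \<in> Poly_Mapping.keys \<alpha>. x i ^ Poly_Mapping.lookup \<alpha> i)"

lemma monom_val_superset:
  assumes "finite A" and "Poly_Mapping.keys \<alpha> \<subseteq> A"
  shows "monom_val \<alpha> x = (\<Prod>i \<in> A. x i ^ Poly_Mapping.lookup \<alpha> i)"
  unfolding monom_val_def
  by (rule prod.mono_neutral_left) (use assms in \<open>auto simp: in_keys_iff\<close>)

lemma monom_val_add: "monom_val (\<alpha> + \<beta>) x = monom_val \<alpha> x * monom_val \<beta> x"
proof -
  let ?A = "Poly_Mapping.keys \<alpha> \<union> Poly_Mapping.keys \<beta>"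
  have "monom_val (\<alpha> + \<beta>) x = (\<Prod>i \<in> ?A. x i ^ Poly_Mapping.lookup (\<alpha> + \<beta>) i)"
    by (rule monom_val_superset) (simp_all add: Poly_Mapping.keys_add)
  also have "\<dots> = monom_val \<alpha> x * monom_val \<beta> x"
    by (subst (1 2) monom_val_superset[of ?A])
      (auto simp: lookup_add power_add prod.distrib)
  finally show ?thesis .
qed

lemma ev_superset:
  assumes "finite A" and "Poly_Mapping.keys p \<subseteq> A"
  shows "ev p x = (\<Sum>\<alpha> \<in> A. Poly_Mapping.lookup p \<alpha> * monom_val \<alpha> x)"
  unfolding ev_def monom_val_def
  by (rule sum.mono_neutral_left) (use assms in \<open>auto simp: in_keys_iff\<close>)

lemma ev_single: "ev (Poly_Mapping.single \<alpha> c) x = c * monom_val \<alpha> x"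
  by (subst ev_superset[of "{\<alpha>}"]) auto

lemma ev_add: "ev (p + q) x = ev p x + ev q x"
proof -
  let ?A = "Poly_Mapping.keys p \<union> Poly_Mapping.keys q"
  have "ev (p + q) x = (\<Sum>\<alpha> \<in> ?A. Poly_Mapping.lookup (p + q) \<alpha> * monom_val \<alpha> x)"
    by (rule ev_superset) (simp_all add: Poly_Mapping.keys_add)
  also have "\<dots> = ev p x + ev q x"
    by (subst (1 2) ev_superset[of ?A]) (auto simp: lookup_add algebra_simps sum.distrib)
  finally show ?thesis .
qed

lemma ev_zero: "ev 0 x = 0"
  by (simp add: ev_def)

lemma poly_mapping_additive_induct:
  fixes p :: "'a \<Rightarrow>\<^sub>0 'b::comm_monoid_add"
  assumes "P 0" and "\<And>k v. P (Poly_Mapping.single k v)"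
    and "\<And>p q. P p \<Longrightarrow> P q \<Longrightarrow> P (p + q)"
  shows "P p"
proof (induction p rule: update_induct)
  case const
  then show ?case by (rule assms(1))
next
  case (update p a b)
  have "Poly_Mapping.update a b p = p + Poly_Mapping.single a b"
    using update(1) by (intro poly_mapping_eqI)
      (auto simp: lookup_update lookup_add lookup_single when_def in_keys_iff)
  then show ?case using assms(2,3) update by metis
qed

lemma ev_mult: "ev (p * q) x = ev p x * ev q x"
proof (induction p rule: poly_mapping_additive_induct)
  case (2 k v)
  show ?case
    by (induction q rule: poly_mapping_additive_induct)
      (simp_all add: ev_zero ev_single mult_single monom_val_add ev_add algebra_simps)
qed (simp_all add: ev_zero ev_add algebra_simps)

text \<open>
  The polynomial sought is a polynomial expression in the given ones, with coefficients that depend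
  on a recursion over a list.  Closure properties of functions are easier to follow through this
  recursion than explicit elements of the polynomial ring.
\<close>

definition polynomial_function :: "nat \<Rightarrow> ((nat \<Rightarrow> real) \<Rightarrow> real) \<Rightarrow> bool" where
  "polynomial_function n f \<longleftrightarrow> (\<exists>p \<in> mpoly_ring n. \<forall>x. ev p x = f x)"

lemma polynomial_function_ev: "p \<in> mpoly_ring n \<Longrightarrow> polynomial_function n (ev p)"
  by (auto simp: polynomial_function_def)

lemma polynomial_function_const: "polynomial_function n (\<lambda>x. c)"
proof -
  have "Poly_Mapping.single 0 c \<in> mpoly_ring n"
    by (simp add: mpoly_ring_def)
  then show ?thesis
    unfolding polynomial_function_def
    by (rule bexI[rotated]) (simp add: ev_single monom_val_def)
qed

lemma polynomial_function_var:
  assumes "i \<in> {1..n}"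
  shows "polynomial_function n (\<lambda>x. x i)"
proof -
  have "Poly_Mapping.single (Poly_Mapping.single i 1) (1::real) \<in> mpoly_ring n"
    using assms by (simp add: mpoly_ring_def)
  then show ?thesis
    unfolding polynomial_function_def
    by (rule bexI[rotated]) (simp add: ev_single monom_val_def)
qed

lemma polynomial_function_add:
  assumes "polynomial_function n f" "polynomial_function n h"
  shows "polynomial_function n (\<lambda>x. f x + h x)"
proof -
  obtain p q where "p \<in> mpoly_ring n" "q \<in> mpoly_ring n"
    and "\<And>x. ev p x = f x" "\<And>x. ev q x = h x"
    using assms unfolding polynomial_function_def by blast
  then show ?thesis
    unfolding polynomial_function_def
    by (intro bexI[of _ "p + q"])
      (auto simp: ev_add mpoly_ring_def dest!: Poly_Mapping.keys_add[THEN subsetD])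
qed

lemma polynomial_function_mult:
  assumes "polynomial_function n f" "polynomial_function n h"
  shows "polynomial_function n (\<lambda>x. f x * h x)"
proof -
  obtain p q where pq: "p \<in> mpoly_ring n" "q \<in> mpoly_ring n"
    and e: "\<And>x. ev p x = f x" "\<And>x. ev q x = h x"
    using assms unfolding polynomial_function_def by blast
  have "Poly_Mapping.keys \<gamma> \<subseteq> {1..n}" if \<gamma>: "\<gamma> \<in> Poly_Mapping.keys (p * q)" for \<gamma>
  proof -
    obtain \<alpha> \<beta> where "\<gamma> = \<alpha> + \<beta>" "\<alpha> \<in> Poly_Mapping.keys p" "\<beta> \<in> Poly_Mapping.keys q"
      using subsetD[OF keys_mult \<gamma>] by blast
    then show ?thesis
      using pq Poly_Mapping.keys_add[of \<alpha> \<beta>] unfolding mpoly_ring_def by blast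
  qed
  then show ?thesis
    unfolding polynomial_function_def using e
    by (intro bexI[of _ "p * q"]) (auto simp: ev_mult mpoly_ring_def)
qed

lemma polynomial_function_power:
  assumes "polynomial_function n f"
  shows "polynomial_function n (\<lambda>x. f x ^ k)"
  by (induction k) (simp_all add: polynomial_function_const polynomial_function_mult assms)

lemma polynomial_function_diff:
  assumes "polynomial_function n f" "polynomial_function n h"
  shows "polynomial_function n (\<lambda>x. f x - h x)"
  using polynomial_function_add[OF assms(1)
      polynomial_function_mult[OF polynomial_function_const[of n "-1"] assms(2)]]
  by simp

lemma polynomial_function_prod_list:
  assumes "\<And>f. f \<in> set fs \<Longrightarrow> polynomial_function n f"
  shows "polynomial_function n (\<lambda>x. \<Prod>f\<leftarrow>fs. f x)"
  using assms
  by (induction fs) (simp_all add: polynomial_function_const polynomial_function_mult)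

lemmas polynomial_function_intros =
  polynomial_function_const polynomial_function_add polynomial_function_mult
  polynomial_function_diff polynomial_function_power polynomial_function_prod_list

section \<open>Towers of squares\<close>

text \<open>
  The parameter \<open>q\<close> is the size to which \<open>u\<close> is confined.  In the recursive call the confinement of
  \<open>4 (1 + g\<^sup>2) u\<^sup>2\<close> to the interval of radius \<open>\<bar>g q\<^sup>2\<bar>\<close> about \<open>2 g q\<^sup>2\<close> does two things: the
  interval lies on the negative side when \<open>g < 0\<close> and \<open>q \<noteq> 0\<close>, and its endpoints are at most \<open>4 (1 + g\<^sup>2) q\<^sup>2\<close>.
\<close>

fun tower :: "real list \<Rightarrow> real \<Rightarrow> real \<Rightarrow> real" where
  "tower [] q u = u\<^sup>2 - q\<^sup>2"
| "tower (g # gs) q u = tower gs (g * q\<^sup>2) (4 * (1 + g\<^sup>2) * u\<^sup>2 - 2 * (g * q\<^sup>2))"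

lemma polynomial_function_tower:
  assumes "\<And>f. f \<in> set fs \<Longrightarrow> polynomial_function n f"
    and "polynomial_function n q" and "polynomial_function n u"
  shows "polynomial_function n (\<lambda>x. tower (map (\<lambda>f. f x) fs) (q x) (u x))"
  using assms
proof (induction fs arbitrary: q u)
  case Nil
  then show ?case by (auto intro!: polynomial_function_intros)
next
  case (Cons f fs)
  have f: "polynomial_function n f" using Cons.prems(1) by simp
  have "polynomial_function n (\<lambda>x. tower (map (\<lambda>f. f x) fs) (f x * (q x)\<^sup>2)
      (4 * (1 + (f x)\<^sup>2) * (u x)\<^sup>2 - 2 * (f x * (q x)\<^sup>2)))"
    by (rule Cons.IH)
      (use Cons.prems f in \<open>auto intro!: polynomial_function_intros\<close>)
  then show ?case by simp
qed

lemma tower_nonpos_imp_abs_le: "tower gs q u \<le> 0 \<Longrightarrow> \<bar>u\<bar> \<le> \<bar>q\<bar>"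
proof (induction gs arbitrary: q u)
  case Nil
  then show ?case by (simp add: abs_le_square_iff)
next
  case (Cons g gs)
  have "\<bar>4 * (1 + g\<^sup>2) * u\<^sup>2 - 2 * (g * q\<^sup>2)\<bar> \<le> \<bar>g * q\<^sup>2\<bar>"
    using Cons by simp
  then have "4 * (1 + g\<^sup>2) * u\<^sup>2 \<le> 3 * \<bar>g\<bar> * q\<^sup>2"
    by (simp add: abs_mult)
  also have "\<dots> \<le> 4 * (1 + g\<^sup>2) * q\<^sup>2"
  proof -
    have "0 \<le> (\<bar>g\<bar> - 1)\<^sup>2" by simp
    then have "3 * \<bar>g\<bar> \<le> 4 * (1 + g\<^sup>2)" by (simp add: power2_diff)
    then show ?thesis by (simp add: mult_right_mono)
  qed
  finally have "u\<^sup>2 \<le> q\<^sup>2"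
    by (smt (verit) mult_le_cancel_left_pos zero_le_power2)
  then show ?case by (simp add: abs_le_square_iff)
qed

lemma tower_nonpos_imp_pos:
  assumes "tower gs q u \<le> 0" and "q \<noteq> 0" and "0 \<notin> set gs" and "g \<in> set gs"
  shows "g > 0"
  using assms
proof (induction gs arbitrary: q u)
  case (Cons h gs)
  let ?v = "4 * (1 + h\<^sup>2) * u\<^sup>2 - 2 * (h * q\<^sup>2)"
  have v: "tower gs (h * q\<^sup>2) ?v \<le> 0" using Cons.prems by simp
  have "h > 0"
  proof (rule ccontr)
    assume "\<not> h > 0"
    then have "h * q\<^sup>2 < 0" using Cons.prems by (auto simp: mult_neg_pos)
    moreover have "4 * (1 + h\<^sup>2) * u\<^sup>2 \<ge> 0" by simp
    ultimately show False using tower_nonpos_imp_abs_le[OF v] by linarith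
  qed
  then show ?case using Cons.IH[OF v] Cons.prems by auto
qed simp

lemma abs_prod_list_le_prod_list_one_plus_square:
  fixes gs :: "real list"
  shows "\<bar>prod_list gs\<bar> \<le> (\<Prod>g\<leftarrow>gs. 1 + g\<^sup>2)"
proof (induction gs)
  case (Cons g gs)
  have "0 \<le> (\<bar>g\<bar> - 1)\<^sup>2" by simp
  then have "2 * \<bar>g\<bar> \<le> 1 + g\<^sup>2" by (simp add: power2_diff)
  then have "\<bar>g\<bar> \<le> 1 + g\<^sup>2" by linarith
  with Cons show ?case by (auto simp: abs_mult intro!: mult_mono)
qed simp

lemma prod_list_one_plus_square_ge_1:
  fixes gs :: "real list"
  shows "(\<Prod>g\<leftarrow>gs. 1 + g\<^sup>2) \<ge> 1"
proof (induction gs)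
  case (Cons g gs)
  then have "1 * 1 \<le> (1 + g\<^sup>2) * (\<Prod>g\<leftarrow>gs. 1 + g\<^sup>2)" by (intro mult_mono) auto
  then show ?case by simp
qed simp

text \<open>
  Solving the chain backwards, from \<open>u = 0\<close> at its end, makes the tower negative.  For \<open>q = 1\<close> the
  depth of the dip is a monomial in the entries of \<open>gs\<close> with exponents at most \<open>2 ^ length gs\<close>, and
  so it can be small; the estimate measures it against the power with exponent \<open>2 ^ length gs\<close> of
  \<open>prod_list gs / (\<Prod>g\<leftarrow>gs. 1 + g\<^sup>2)\<close>, the reciprocal of the lower bound for the
  squared last variable in \<open>separator_dip\<close>.  The general \<open>q\<close> is there for the induction.
\<close>

lemma tower_dip:
  assumes "\<forall>g \<in> set gs. g > 0" and "q > 0"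
  shows "\<exists>u. tower gs q u * (\<Prod>g\<leftarrow>gs. 1 + g\<^sup>2) ^ (2 ^ length gs)
    \<le> - (q ^ (2 * 2 ^ length gs) * prod_list gs ^ (2 ^ length gs)) \<and> tower gs q u \<le> 0"
  using assms
proof (induction gs arbitrary: q)
  case Nil
  then show ?case by (intro exI[of _ 0]) simp
next
  case (Cons g gs)
  define N :: nat where "N = 2 ^ length gs"
  define W where "W = (\<Prod>g\<leftarrow>gs. 1 + g\<^sup>2)"
  define p where "p = prod_list gs"
  have g: "g > 0" and gs: "\<forall>g \<in> set gs. g > 0" using Cons.prems by auto
  have q': "g * q\<^sup>2 > 0" using g Cons.prems by simp
  obtain v where v: "tower gs (g * q\<^sup>2) v * W ^ N \<le> - ((g * q\<^sup>2) ^ (2 * N) * p ^ N)"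
      "tower gs (g * q\<^sup>2) v \<le> 0"
    using Cons.IH[OF gs q'] unfolding N_def W_def p_def by blast
  define T where "T = - tower gs (g * q\<^sup>2) v"
  \<comment> \<open>The preimage of \<open>v\<close>; the radicand is nonnegative because the next stage confines \<open>v\<close>.\<close>
  define u where "u = sqrt ((2 * (g * q\<^sup>2) + v) / (4 * (1 + g\<^sup>2)))"
  have "\<bar>v\<bar> \<le> g * q\<^sup>2" using tower_nonpos_imp_abs_le[OF v(2)] q' by simp
  then have "2 * (g * q\<^sup>2) + v \<ge> 0" using q' by linarith
  then have u2: "u\<^sup>2 = (2 * (g * q\<^sup>2) + v) / (4 * (1 + g\<^sup>2))"
    unfolding u_def by (intro real_sqrt_pow2 divide_nonneg_nonneg) auto
  have "1 + g\<^sup>2 > 0" by (simp add: add_pos_nonneg)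
  then have "4 * (1 + g\<^sup>2) * u\<^sup>2 - 2 * (g * q\<^sup>2) = v"
    unfolding u2 by (simp add: field_simps)
  then have tu: "tower (g # gs) q u = - T" by (simp add: T_def)
  have p: "0 < p" unfolding p_def using gs by (induction gs) auto
  have pW: "p \<le> W"
    using abs_prod_list_le_prod_list_one_plus_square[of gs] by (simp add: p_def W_def)
  have T: "(g * q\<^sup>2) ^ (2 * N) * p ^ N \<le> T * W ^ N" "T \<ge> 0"
    using v by (auto simp: T_def)
  have "q ^ (4 * N) * (g * p) ^ (2 * N) = (g * q\<^sup>2) ^ (2 * N) * p ^ N * p ^ N"
  proof -
    have "q ^ (4 * N) = (q\<^sup>2) ^ (2 * N)" by (simp flip: power_mult)
    moreover have "p ^ (2 * N) = p ^ N * p ^ N" by (simp add: mult_2 power_add)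
    ultimately show ?thesis by (simp add: power_mult_distrib)
  qed
  also have "\<dots> \<le> (T * W ^ N) * W ^ N"
    using T p pW by (intro mult_mono[OF T(1)] power_mono) auto
  also have "\<dots> = T * W ^ (2 * N) * 1" by (simp add: mult_2 power_add)
  also have "\<dots> \<le> T * W ^ (2 * N) * (1 + g\<^sup>2) ^ (2 * N)"
    using T p pW by (intro mult_left_mono one_le_power) auto
  finally have "q ^ (4 * N) * (g * p) ^ (2 * N) \<le> T * ((1 + g\<^sup>2) * W) ^ (2 * N)"
    by (simp add: power_mult_distrib mult_ac)
  then show ?case
    using tu T by (intro exI[of _ u]) (simp add: N_def W_def p_def)
qed

section \<open>The polynomial in the last variable\<close>

text \<open>
  The constant \<open>2\<close> exceeds the bound \<open>1\<close> on \<open>u\<close>, which leaves the strict inequality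
  \<open>G\<^sup>2 W < p t\<^sup>2\<close> wherever the tower is nonpositive.
\<close>

definition separator :: "real list \<Rightarrow> real \<Rightarrow> real \<Rightarrow> real" where
  "separator gs G t = (1 + t\<^sup>2) ^ (2 ^ length gs) *
     tower gs 1 (prod_list gs * t\<^sup>2 - (2 + G\<^sup>2 * (\<Prod>g\<leftarrow>gs. 1 + g\<^sup>2)))"

lemma separator_nonpos_iff:
  "separator gs G t \<le> 0 \<longleftrightarrow>
     tower gs 1 (prod_list gs * t\<^sup>2 - (2 + G\<^sup>2 * (\<Prod>g\<leftarrow>gs. 1 + g\<^sup>2))) \<le> 0"
proof -
  have "(1 + t\<^sup>2) ^ (2 ^ length gs) > 0" by (simp add: add_pos_nonneg)
  then show ?thesis by (simp add: separator_def mult_le_0_iff)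
qed

lemma separator_zero_pos: "separator gs G 0 > 0"
proof (rule ccontr)
  let ?W = "\<Prod>g\<leftarrow>gs. 1 + g\<^sup>2"
  assume "\<not> separator gs G 0 > 0"
  then have "\<bar>prod_list gs * 0\<^sup>2 - (2 + G\<^sup>2 * ?W)\<bar> \<le> \<bar>1\<bar>"
    by (intro tower_nonpos_imp_abs_le[of gs]) (metis not_less separator_nonpos_iff)
  moreover have "G\<^sup>2 * ?W \<ge> 0"
    using prod_list_one_plus_square_ge_1[of gs] by (intro mult_nonneg_nonneg) auto
  ultimately show False by simp
qed

text \<open>
  Positivity of \<open>p t\<^sup>2\<close> excludes the zeros of the entries of \<open>gs\<close>, which the tower alone cannot
  detect.
\<close>

lemma separator_nonpos_imp:
  assumes "separator gs G t \<le> 0" and "G > 0"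
  shows "\<forall>g \<in> set gs. g > 0" and "\<bar>t\<bar> > G" and "\<bar>t\<bar> > G / sqrt (prod_list gs)"
proof -
  define W where "W = (\<Prod>g\<leftarrow>gs. 1 + g\<^sup>2)"
  define p where "p = prod_list gs"
  have t: "tower gs 1 (p * t\<^sup>2 - (2 + G\<^sup>2 * W)) \<le> 0"
    using assms unfolding separator_nonpos_iff p_def W_def by simp
  have W: "1 \<le> W" "p \<le> W"
    using prod_list_one_plus_square_ge_1[of gs] abs_prod_list_le_prod_list_one_plus_square[of gs]
    by (simp_all add: W_def p_def)
  have big: "G\<^sup>2 * W < p * t\<^sup>2"
    using tower_nonpos_imp_abs_le[OF t] by simp
  moreover have "0 \<le> G\<^sup>2 * W" using W by simp
  ultimately have "0 < p * t\<^sup>2" by linarith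
  then have p: "p > 0" by (simp add: zero_less_mult_iff)
  then have "0 \<notin> set gs" using prod_list_zero_iff[of gs] by (auto simp: p_def)
  then show "\<forall>g \<in> set gs. g > 0"
    using tower_nonpos_imp_pos[OF t] by auto
  have "G\<^sup>2 * p \<le> G\<^sup>2 * W" using W by (intro mult_left_mono) auto
  then have "G\<^sup>2 * p < t\<^sup>2 * p" using big by (simp add: mult.commute)
  then have "G\<^sup>2 < t\<^sup>2" using p by simp
  then show "\<bar>t\<bar> > G" using assms(2) power2_le_iff_abs_le[of G t] by (meson less_imp_le not_less)
  have "G\<^sup>2 * 1 \<le> G\<^sup>2 * W" using W by (intro mult_left_mono) auto
  then have "G\<^sup>2 < p * t\<^sup>2" using big by simp
  then have "sqrt (G\<^sup>2) < sqrt (p * t\<^sup>2)" by (rule real_sqrt_less_mono)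
  then have "G < sqrt p * \<bar>t\<bar>" using assms(2) by (simp add: real_sqrt_mult)
  then show "\<bar>t\<bar> > G / sqrt (prod_list gs)"
    using p by (simp add: p_def[symmetric] divide_less_eq mult.commute)
qed

text \<open>
  The point \<open>t\<close> at which the tower argument takes the value of \<open>tower_dip\<close> satisfies
  \<open>t\<^sup>2 \<ge> W / p\<close>; the power of \<open>1 + t\<^sup>2\<close> thus cancels the smallness of the dip.
\<close>

lemma separator_dip:
  assumes "\<forall>g \<in> set gs. g > 0" and "G \<ge> 1"
  shows "\<exists>t>0. separator gs G t \<le> -1"
proof -
  define W where "W = (\<Prod>g\<leftarrow>gs. 1 + g\<^sup>2)"
  define p where "p = prod_list gs"
  define N :: nat where "N = 2 ^ length gs"
  obtain u where u: "tower gs 1 u * W ^ N \<le> - (p ^ N)" "tower gs 1 u \<le> 0"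
    using tower_dip[OF assms(1), of 1] by (auto simp: W_def p_def N_def)
  have p: "0 < p" unfolding p_def using assms(1) by (induction gs) auto
  have W: "1 \<le> W" using prod_list_one_plus_square_ge_1[of gs] by (simp add: W_def)
  define d where "d = 2 + G\<^sup>2 * W + u"
  have "1 * W \<le> G\<^sup>2 * W" using assms(2) W by (intro mult_right_mono) auto
  moreover have "\<bar>u\<bar> \<le> 1" using tower_nonpos_imp_abs_le[OF u(2)] by simp
  ultimately have d: "W \<le> d" by (simp add: d_def)
  define t where "t = sqrt (d / p)"
  have t: "t > 0" "t\<^sup>2 = d / p" using d W p by (simp_all add: t_def)
  have "separator gs G t = (1 + d / p) ^ N * tower gs 1 u"
    using p by (simp add: separator_def t(2) d_def flip: W_def p_def N_def)
  also have "\<dots> \<le> (W / p) ^ N * tower gs 1 u"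
  proof -
    have "W / p \<le> d / p" using d p by (intro divide_right_mono) auto
    then show ?thesis using W p u(2) by (intro mult_right_mono_neg power_mono) auto
  qed
  also have "\<dots> = tower gs 1 u * W ^ N / p ^ N"
    by (simp add: power_divide)
  also have "\<dots> \<le> - (p ^ N) / p ^ N"
    using u p by (intro divide_right_mono) auto
  also have "\<dots> = -1" using p by simp
  finally show ?thesis using t by blast
qed

lemma poly_root_between_0_and_nonpos:
  fixes f :: "real poly"
  assumes "poly f 0 > 0" and "t > 0" and "poly f t \<le> 0"
  shows "\<exists>r. 0 < r \<and> r \<le> t \<and> poly f r = 0"
proof (cases "poly f t = 0")
  case False
  then show ?thesis using poly_IVT_neg[of 0 t f] assms by fastforce
qed (use assms in auto)

section \<open>Points of the space\<close>

lemma pt_in_Rn: "n \<ge> 1 \<Longrightarrow> x' \<in> Rn (n - 1) \<Longrightarrow> pt n x' t \<in> Rn n"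
  unfolding Rn_def pt_def by (auto simp: PiE_iff extensional_def)

lemma pt_surj:
  assumes "n \<ge> 1" and "x \<in> Rn n"
  obtains x' where "x' \<in> Rn (n - 1)" "x = pt n x' (x n)"
proof
  show "x(n := undefined) \<in> Rn (n - 1)"
    using assms unfolding Rn_def by (auto simp: PiE_iff extensional_def)
qed (simp add: pt_def)

lemma pt_inject:
  assumes "n \<ge> 1" and "x' \<in> Rn (n - 1)" and "y' \<in> Rn (n - 1)" and "pt n x' s = pt n y' t"
  shows "x' = y'"
proof
  fix i
  have "x' n = undefined" "y' n = undefined"
    using assms by (auto simp: Rn_def PiE_iff extensional_def)
  then show "x' i = y' i"
    using fun_cong[OF assms(4), of i] by (cases "i = n") (auto simp: pt_def)
qed

lemma pt_in_assoc_set_iff: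
  assumes "n \<ge> 1" and "x' \<in> Rn (n - 1)"
  shows "pt n x' 0 \<in> assoc_set n m g \<longleftrightarrow> (\<forall>i \<in> {1..m}. ev (g i) x' > 0)"
  using assms pt_inject[OF assms(1)] unfolding assoc_set_def by blast

lemma mpoly_ring_mono: "k \<le> n \<Longrightarrow> mpoly_ring k \<subseteq> mpoly_ring n"
  unfolding mpoly_ring_def by fastforce

lemma ev_pt:
  assumes "p \<in> mpoly_ring (n - 1)" and "n \<ge> 1"
  shows "ev p (pt n x' t) = ev p x'"
proof -
  have "i \<noteq> n" if "\<alpha> \<in> Poly_Mapping.keys p" "i \<in> Poly_Mapping.keys \<alpha>" for \<alpha> i
    using that assms unfolding mpoly_ring_def by fastforce
  then show ?thesis
    unfolding ev_def pt_def by (intro sum.cong prod.cong arg_cong2[of _ _ _ _ "(*)"]) auto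
qed

lemma exists_separator_mpoly:
  assumes "n \<ge> 1" and "\<And>i. i \<in> {1..m} \<Longrightarrow> g i \<in> mpoly_ring (n - 1)"
    and "h \<in> mpoly_ring (n - 1)"
  shows "\<exists>Q \<in> mpoly_ring n. \<forall>x' t.
    ev Q (pt n x' t) = separator (map (\<lambda>i. ev (g i) x') [1..<Suc m]) (ev h x') t"
proof -
  let ?fs = "map (\<lambda>i. ev (g i)) [1..<Suc m]"
  let ?S = "\<lambda>x. separator (map (\<lambda>f. f x) ?fs) (ev h x) (x n)"
  have sub: "mpoly_ring (n - 1) \<subseteq> mpoly_ring n" by (rule mpoly_ring_mono) simp
  have gs: "polynomial_function n (ev (g i))" if "Suc 0 \<le> i" "i < Suc m" for i
    using assms(2) sub that by (auto intro!: polynomial_function_ev)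
  have fs: "\<And>f. f \<in> set ?fs \<Longrightarrow> polynomial_function n f"
    by (auto simp del: upt_Suc intro!: gs)
  have h: "polynomial_function n (ev h)"
    using assms(3) sub by (auto intro!: polynomial_function_ev)
  have last: "polynomial_function n (\<lambda>x. x n)"
    using assms(1) by (intro polynomial_function_var) simp
  have p: "polynomial_function n (\<lambda>x. prod_list (map (\<lambda>f. f x) ?fs))"
    by (rule polynomial_function_prod_list) (rule fs)
  have W: "polynomial_function n (\<lambda>x. prod_list (map (\<lambda>f. 1 + (f x)\<^sup>2) ?fs))"
  proof -
    have "polynomial_function n (\<lambda>x. prod_list (map (\<lambda>f. f x) (map (\<lambda>f x. 1 + (f x)\<^sup>2) ?fs)))"
      by (rule polynomial_function_prod_list)
        (auto simp del: upt_Suc intro!: polynomial_function_intros gs)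
    then show ?thesis by (simp add: o_def del: upt_Suc)
  qed
  have "polynomial_function n (\<lambda>x. tower (map (\<lambda>f. f x) ?fs) 1
      (prod_list (map (\<lambda>f. f x) ?fs) * (x n)\<^sup>2
        - (2 + (ev h x)\<^sup>2 * prod_list (map (\<lambda>f. 1 + (f x)\<^sup>2) ?fs))))"
    by (rule polynomial_function_tower)
      (use p W h last fs in \<open>(assumption | intro polynomial_function_add polynomial_function_mult
        polynomial_function_diff polynomial_function_power polynomial_function_const | blast)+\<close>)
  then have "polynomial_function n (\<lambda>x. (1 + (x n)\<^sup>2) ^ (2 ^ m) *
      tower (map (\<lambda>f. f x) ?fs) 1 (prod_list (map (\<lambda>f. f x) ?fs) * (x n)\<^sup>2
        - (2 + (ev h x)\<^sup>2 * prod_list (map (\<lambda>f. 1 + (f x)\<^sup>2) ?fs))))"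
    using last by (intro polynomial_function_intros)
  then have "polynomial_function n ?S"
    by (simp add: separator_def o_def del: upt_Suc)
  then obtain Q where Q: "Q \<in> mpoly_ring n" "\<And>x. ev Q x = ?S x"
    unfolding polynomial_function_def by blast
  have "ev Q (pt n x' t) = separator (map (\<lambda>i. ev (g i) x') [1..<Suc m]) (ev h x') t" for x' t
  proof -
    have "map (\<lambda>f. f (pt n x' t)) ?fs = map (\<lambda>i. ev (g i) x') [1..<Suc m]"
      using assms by (auto simp del: upt_Suc simp: ev_pt)
    moreover have "ev h (pt n x' t) = ev h x'" using assms by (simp add: ev_pt)
    moreover have "pt n x' t n = t" by (simp add: pt_def)
    ultimately show ?thesis by (simp only: Q(2))
  qed
  with Q(1) show ?thesis by blast
qed

theorem lemma3p2:
  fixes n m :: nat and g :: "nat \<Rightarrow> real_mpoly"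
  assumes "n \<ge> 1" and "m \<ge> 1" and "admissible_tuple n m g"
  shows "\<exists>Q \<in> mpoly_ring n.
    {x \<in> Rn n. ev Q x \<le> 0} \<subseteq>
      {pt n x' t | x' t. x' \<in> Rn (n - 1) \<and> pt n x' 0 \<in> assoc_set n m g \<and>
         \<bar>t\<bar> > max (ev (g (m + 1)) x')
                   (ev (g (m + 1)) x' / sqrt (\<Prod>i = 1..m. ev (g i) x'))} \<and>
    (\<forall>x' \<in> Rn (n - 1). pt n x' 0 \<in> assoc_set n m g \<longrightarrow>
      (\<exists>r t. r > 0 \<and> r \<ge> ev (g (m + 1)) x' \<and> poly (spec_last n Q x') r = 0 \<and>
             t \<ge> r \<and> ev Q (pt n x' t) = -1)) \<and>
    proj_last n ` upper_set n Q = assoc_set n m g \<and>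
    (\<forall>x' \<in> Rn (n - 1). \<forall>x\<^sub>n. pt n x' x\<^sub>n \<in> upper_set n Q \<longrightarrow>
      (\<exists>r t. r > 0 \<and> t \<ge> 0 \<and> x\<^sub>n = r + t \<and> ev Q (pt n x' r) = 0))"
proof -
  let ?gs = "\<lambda>x'. map (\<lambda>i. ev (g i) x') [1..<Suc m]"
  let ?G = "ev (g (m + 1))"
  obtain Q where Q: "Q \<in> mpoly_ring n"
    and evQ: "\<And>x' t. ev Q (pt n x' t) = separator (?gs x') (?G x') t"
    using exists_separator_mpoly[of n m g "g (m + 1)"] assms
    unfolding admissible_tuple_def by auto
  have G: "?G x' > 1" if "x' \<in> Rn (n - 1)" for x'
    using assms(3) that unfolding admissible_tuple_def by blast
  have prod: "prod_list (?gs x') = (\<Prod>i = 1..m. ev (g i) x')" for x'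
    using prod.distinct_set_conv_list[of "[1..<Suc m]" "\<lambda>i. ev (g i) x'"]
    by (simp add: atLeastLessThanSuc_atLeastAtMost del: upt_Suc)
  have in_assoc: "pt n x' 0 \<in> assoc_set n m g \<longleftrightarrow> (\<forall>a \<in> set (?gs x'). a > 0)"
    if "x' \<in> Rn (n - 1)" for x'
    using pt_in_assoc_set_iff[OF assms(1) that, of m g]
    by (simp add: atLeastLessThanSuc_atLeastAtMost del: upt_Suc)

  have nonpos: "pt n x' 0 \<in> assoc_set n m g" "\<bar>t\<bar> > ?G x'"
    "\<bar>t\<bar> > ?G x' / sqrt (\<Prod>i = 1..m. ev (g i) x')"
    if x': "x' \<in> Rn (n - 1)" and neg: "ev Q (pt n x' t) \<le> 0" for x' t
  proof -
    have s: "separator (?gs x') (?G x') t \<le> 0" and G0: "?G x' > 0"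
      using neg G[OF x'] unfolding evQ by auto
    show "pt n x' 0 \<in> assoc_set n m g"
      using separator_nonpos_imp(1)[OF s G0] in_assoc[OF x'] by blast
    show "\<bar>t\<bar> > ?G x'" by (rule separator_nonpos_imp(2)[OF s G0])
    show "\<bar>t\<bar> > ?G x' / sqrt (\<Prod>i = 1..m. ev (g i) x')"
      using separator_nonpos_imp(3)[OF s G0] unfolding prod .
  qed

  have root: "\<exists>r. 0 < r \<and> r \<le> t \<and> ev Q (pt n x' r) = 0"
    if "t > 0" "ev Q (pt n x' t) \<le> 0" for x' t
    using poly_root_between_0_and_nonpos[of "spec_last n Q x'" t] that separator_zero_pos
    by (simp add: poly_spec_last evQ)

  have dip: "\<exists>r t. r > 0 \<and> r \<ge> ?G x' \<and> poly (spec_last n Q x') r = 0 \<and> t \<ge> r \<and>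
      ev Q (pt n x' t) = -1"
    if x': "x' \<in> Rn (n - 1)" and A: "pt n x' 0 \<in> assoc_set n m g" for x'
  proof -
    obtain s where s: "s > 0" "ev Q (pt n x' s) \<le> -1"
      using separator_dip[of "?gs x'" "?G x'"] A in_assoc[OF x'] G[OF x'] unfolding evQ by force
    obtain r where r: "0 < r" "r \<le> s" "ev Q (pt n x' r) = 0"
      using root[of s x'] s by auto
    have "\<exists>t\<ge>r. t \<le> s \<and> poly (spec_last n Q x') t = -1"
      using r s by (intro IVT2 allI impI poly_isCont) (auto simp: poly_spec_last)
    then obtain t where "t \<ge> r" "ev Q (pt n x' t) = -1"
      by (auto simp: poly_spec_last)
    moreover have "r \<ge> ?G x'"
      using nonpos(2)[OF x', of r] r by simp
    ultimately show ?thesis using r by (auto simp: poly_spec_last)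
  qed

  have proj: "proj_last n (pt n x' t) = pt n x' 0" for x' t
    by (simp add: proj_last_def pt_def)

  show ?thesis
  proof (rule bexI[OF _ Q], intro conjI)
    show "{x \<in> Rn n. ev Q x \<le> 0} \<subseteq>
      {pt n x' t | x' t. x' \<in> Rn (n - 1) \<and> pt n x' 0 \<in> assoc_set n m g \<and>
         \<bar>t\<bar> > max (?G x') (?G x' / sqrt (\<Prod>i = 1..m. ev (g i) x'))}"
    proof
      fix x assume "x \<in> {x \<in> Rn n. ev Q x \<le> 0}"
      then have x: "x \<in> Rn n" "ev Q x \<le> 0" by auto
      obtain x' where x': "x' \<in> Rn (n - 1)" "x = pt n x' (x n)"
        using pt_surj[OF assms(1) x(1)] by blast
      have "ev Q (pt n x' (x n)) \<le> 0" using x(2) x'(2) by simp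
      from nonpos[OF x'(1) this] x'
      show "x \<in> {pt n x' t | x' t. x' \<in> Rn (n - 1) \<and> pt n x' 0 \<in> assoc_set n m g \<and>
         \<bar>t\<bar> > max (?G x') (?G x' / sqrt (\<Prod>i = 1..m. ev (g i) x'))}"
        by auto
    qed
  next
    show "\<forall>x' \<in> Rn (n - 1). pt n x' 0 \<in> assoc_set n m g \<longrightarrow>
      (\<exists>r t. r > 0 \<and> r \<ge> ?G x' \<and> poly (spec_last n Q x') r = 0 \<and> t \<ge> r \<and>
        ev Q (pt n x' t) = -1)"
      using dip by blast
  next
    show "proj_last n ` upper_set n Q = assoc_set n m g"
    proof (intro equalityI subsetI)
      fix y assume "y \<in> proj_last n ` upper_set n Q"
      then obtain x' t l where "x' \<in> Rn (n - 1)" "ev Q (pt n x' t) \<le> 0"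
        "y = proj_last n (pt n x' (t + l))"
        unfolding upper_set_def by blast
      then show "y \<in> assoc_set n m g" using nonpos(1) by (simp add: proj)
    next
      fix y assume y: "y \<in> assoc_set n m g"
      then obtain x' where x': "x' \<in> Rn (n - 1)" "y = pt n x' 0"
        unfolding assoc_set_def by blast
      obtain r where "r > 0" "ev Q (pt n x' r) = 0"
        using dip[OF x'(1)] y x'(2) by (auto simp: poly_spec_last)
      then have "pt n x' (r + 0) \<in> upper_set n Q"
        unfolding upper_set_def using x'(1) by fastforce
      then show "y \<in> proj_last n ` upper_set n Q"
        by (rule rev_image_eqI) (simp add: proj x'(2))
    qed
  next
    show "\<forall>x' \<in> Rn (n - 1). \<forall>x\<^sub>n. pt n x' x\<^sub>n \<in> upper_set n Q \<longrightarrow>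
      (\<exists>r t. r > 0 \<and> t \<ge> 0 \<and> x\<^sub>n = r + t \<and> ev Q (pt n x' r) = 0)"
    proof (intro ballI allI impI)
      fix x' x\<^sub>n assume x': "x' \<in> Rn (n - 1)" and "pt n x' x\<^sub>n \<in> upper_set n Q"
      then obtain y' t l where y: "pt n x' x\<^sub>n = pt n y' (t + l)" "y' \<in> Rn (n - 1)"
        "ev Q (pt n y' t) \<le> 0" "t > 0" "l \<ge> 0"
        unfolding upper_set_def by blast
      have "x' = y'" by (rule pt_inject[OF assms(1) x' y(2) y(1)])
      moreover have "x\<^sub>n = t + l" using fun_cong[OF y(1), of n] by (simp add: pt_def)
      moreover obtain r where "0 < r" "r \<le> t" "ev Q (pt n y' r) = 0"
        using root[OF y(4) y(3)] by blast
      ultimately show "\<exists>r t. r > 0 \<and> t \<ge> 0 \<and> x\<^sub>n = r + t \<and> ev Q (pt n x' r) = 0"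
        using y(5) by (intro exI[of _ r] exI[of _ "t - r + l"]) auto
    qed
  qed
qed

end
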